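(* For $a=\tfrac12$, the harmonic surface $f:\mathbb{C}\to\mathbb{R}^3$, $f(z)=\operatorname{Re}\int^z(\omega_1,\omega_2,\omega_3)$, given by $$\omega_1=iz\,dz,\qquad \omega_2=\left(z^2+a\right)dz,\qquad \omega_3=\left(iz^4+i\right)dz$$ is complete and properly embedded.
   Context: Complete means the metric induced by $f$ is complete; properly embedded means $f$ is a proper injective immersion. The integral is taken from a fixed base point in $\mathbb{C}$. *)

theory Defs
  imports "HOL-Complex_Analysis.Complex_Analysis"
begin

definition omega :: "complex \<Rightarrow> complex \<Rightarrow> complex ^ 3" where
  "omega a z = vector [\<i> * z, z\<^sup>2 + a, \<i> * z ^ 4 + \<i>]"

text \<open>The integral is taken along the segment from the base point; for entire data any other
  path gives the same value, see \<open>harmonic_surface_path_independent\<close> below.\<close>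

definition harmonic_surface :: "(complex \<Rightarrow> complex ^ 3) \<Rightarrow> complex \<Rightarrow> complex \<Rightarrow> real ^ 3" where
  "harmonic_surface \<phi> z0 z = (\<chi> k. Re (contour_integral (linepath z0 z) (\<lambda>w. \<phi> w $ k)))"

lemma harmonic_surface_path_independent:
  fixes \<phi> :: "complex \<Rightarrow> complex ^ 3"
  assumes "\<And>k. (\<lambda>w. \<phi> w $ k) holomorphic_on UNIV"
    and "valid_path \<gamma>" "pathstart \<gamma> = z0" "pathfinish \<gamma> = z"
  shows "harmonic_surface \<phi> z0 z = (\<chi> k. Re (contour_integral \<gamma> (\<lambda>w. \<phi> w $ k)))"
proof -
  have "contour_integral (linepath z0 z) (\<lambda>w. \<phi> w $ k) = contour_integral \<gamma> (\<lambda>w. \<phi> w $ k)" for k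
  proof -
    obtain F where F: "\<And>w. (F has_field_derivative \<phi> w $ k) (at w)"
      using holomorphic_convex_primitive'[OF convex_UNIV open_UNIV assms(1)[of k]] by auto
    have *: "contour_integral g (\<lambda>w. \<phi> w $ k) = F z - F z0"
      if "valid_path g" "pathstart g = z0" "pathfinish g = z" for g
      using contour_integral_primitive[of UNIV F "\<lambda>w. \<phi> w $ k" g] F that
      by (auto intro: contour_integral_unique)
    show ?thesis
      using *[of \<gamma>] *[of "linepath z0 z"] assms by simp
  qed
  then show ?thesis
    by (simp add: harmonic_surface_def)
qed

text \<open>The length of \<open>\<gamma>\<close> in the pull-back \<open>\<langle>v, w\<rangle>\<^sub>z = df\<^sub>z(v) \<bullet> df\<^sub>z(w)\<close>
  of the Euclidean metric under \<open>f\<close>.\<close>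

definition speed :: "(complex \<Rightarrow> real ^ 'n) \<Rightarrow> (real \<Rightarrow> complex) \<Rightarrow> real \<Rightarrow> real" where
  "speed f \<gamma> t = norm (frechet_derivative f (at (\<gamma> t)) (vector_derivative \<gamma> (at t)))"

definition induced_length :: "(complex \<Rightarrow> real ^ 'n) \<Rightarrow> (real \<Rightarrow> complex) \<Rightarrow> real" where
  "induced_length f \<gamma> = integral {0..1} (speed f \<gamma>)"

text \<open>A \<^const>\<open>valid_path\<close> may have unbounded derivative near its finitely many exceptional
  parameters, and hence infinite length, in which case the integral above has the default value
  \<open>0\<close>. The integrability condition excludes these paths from the infimum.\<close>

definition induced_dist :: "(complex \<Rightarrow> real ^ 'n) \<Rightarrow> complex \<Rightarrow> complex \<Rightarrow> real" where
  "induced_dist f p q =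
     Inf {induced_length f \<gamma> | \<gamma>. valid_path \<gamma> \<and> pathstart \<gamma> = p \<and> pathfinish \<gamma> = q
                                  \<and> speed f \<gamma> integrable_on {0..1}}"

definition complete_surface :: "(complex \<Rightarrow> real ^ 'n) \<Rightarrow> bool" where
  "complete_surface f \<longleftrightarrow>
     Metric_space UNIV (induced_dist f) \<and> Metric_space.mcomplete UNIV (induced_dist f)"

text \<open>In finite dimension, having continuous iterated directional derivatives up to order \<open>k\<close>
  is the same as being of class \<open>C\<^sup>k\<close>.\<close>

primrec Ck :: "nat \<Rightarrow> (complex \<Rightarrow> real ^ 'n) \<Rightarrow> bool" where
  "Ck 0 f \<longleftrightarrow> continuous_on UNIV f"
| "Ck (Suc k) f \<longleftrightarrow>
     (\<forall>z. f differentiable (at z)) \<and> (\<forall>v. Ck k (\<lambda>z. frechet_derivative f (at z) v))"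

definition immersion :: "(complex \<Rightarrow> real ^ 'n) \<Rightarrow> bool" where
  "immersion f \<longleftrightarrow> (\<forall>k. Ck k f) \<and> (\<forall>z. inj (frechet_derivative f (at z)))"

definition properly_embedded :: "(complex \<Rightarrow> real ^ 'n) \<Rightarrow> bool" where
  "properly_embedded f \<longleftrightarrow> immersion f \<and> inj f \<and> proper_map euclidean euclidean f"

lemma proper_map_iff_compact_vimage:
  fixes f :: "complex \<Rightarrow> real ^ 'n"
  assumes "continuous_on UNIV f"
  shows "proper_map euclidean euclidean f \<longleftrightarrow> (\<forall>K. compact K \<longrightarrow> compact (f -` K))"
proof
  assume "proper_map euclidean euclidean f"
  then show "\<forall>K. compact K \<longrightarrow> compact (f -` K)"
    using compactin_proper_map_preimage[of euclidean euclidean f] by (simp add: vimage_def)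
next
  assume "\<forall>K. compact K \<longrightarrow> compact (f -` K)"
  then show "proper_map euclidean euclidean f"
    using assms
    by (intro compact_imp_proper_map)
       (auto simp: vimage_def intro: metrizable_imp_k_space metrizable_space_euclidean
             Hausdorff_imp_kc_space)
qed

end

theory Submission
  imports Defs
begin

text \<open>With \<open>z = x + i y\<close> and up to constants, the surface has the coordinates \<open>- x y\<close>,
  \<open>x\<^sup>3/3 - x y\<^sup>2 + x/2\<close> and \<open>- y (x\<^sup>4 - 2 x\<^sup>2 y\<^sup>2 + y\<^sup>4/5 + 1)\<close>. A bound on all three of them bounds \<open>x\<close>
  and \<open>y\<close>, which gives properness. For injectivity, fix \<open>x y = c\<close> with \<open>c \<noteq> 0\<close>. The second
  coordinate \<open>g\<close> increases along each branch of this hyperbola, and the symmetry \<open>z \<mapsto> -z\<close>, which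
  negates the last two coordinates, reduces a coincidence between the two branches to two points
  of the branch \<open>x > 0\<close> with opposite values of \<open>g\<close> and of the third coordinate \<open>- c h\<close>. This is
  impossible, because \<open>h\<close> is a convex function of \<open>g\<close> which is positive at \<open>g = 0\<close>. Completeness
  is a consequence of proper embeddedness.\<close>

subsection \<open>The induced distance\<close>

lemma speed_affine:
  assumes "\<And>z. f differentiable at z"
    and "\<gamma> differentiable at (m * t + c)" and "open S" "t \<in> S"
    and "\<And>s. s \<in> S \<Longrightarrow> \<delta> s = \<gamma> (m * s + c)"
  shows "speed f \<delta> t = \<bar>m\<bar> * speed f \<gamma> (m * t + c)"
proof -
  have "(\<gamma> has_vector_derivative vector_derivative \<gamma> (at (m * t + c))) (at (m * t + c))"
    using assms(2) vector_derivative_works by blast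
  then have "(\<gamma> \<circ> (\<lambda>s. m * s + c) has_vector_derivative m *\<^sub>R vector_derivative \<gamma> (at (m * t + c))) (at t)"
    by (intro vector_diff_chain_at) (auto intro!: derivative_eq_intros simp: has_vector_derivative_def)
  then have "(\<delta> has_vector_derivative m *\<^sub>R vector_derivative \<gamma> (at (m * t + c))) (at t)"
    by (rule has_vector_derivative_transform_within_open[OF _ assms(3,4)]) (simp add: assms(5))
  then have d: "vector_derivative \<delta> (at t) = m *\<^sub>R vector_derivative \<gamma> (at (m * t + c))"
    by (rule vector_derivative_at)
  have "linear (frechet_derivative f (at (\<delta> t)))"
    by (rule linear_frechet_derivative[OF assms(1)])
  then show ?thesis
    using assms(4,5) by (simp add: speed_def d linear_scale)
qed

lemma valid_path_differentiable:
  assumes "valid_path \<gamma>"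
  obtains S where "finite S" "\<And>t. t \<in> {0..1} - S \<Longrightarrow> \<gamma> differentiable at t"
  using assms unfolding valid_path_def piecewise_C1_differentiable_on_def C1_differentiable_on_eq
  by blast

text \<open>Substitution in the length integral. The slope \<open>m = 2\<close> serves the two
  halves of a joined path, \<open>m = -1\<close> the reversed path.\<close>

lemma has_integral_speed_affine:
  assumes f: "\<And>z. f differentiable at z"
    and "valid_path \<gamma>" and I: "(speed f \<gamma> has_integral I) {0..1}"
    and "m \<noteq> 0" and ab: "{a..b} = (\<lambda>x. (x - c) / m) ` {0..1}"
    and \<delta>: "\<And>s. s \<in> {a<..<b} \<Longrightarrow> \<delta> s = \<gamma> (m * s + c)"
  shows "(speed f \<delta> has_integral I) {a..b}"
proof -
  obtain S where S: "finite S" "\<And>t. t \<in> {0..1} - S \<Longrightarrow> \<gamma> differentiable at t"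
    using valid_path_differentiable[OF assms(2)] by metis
  have "((\<lambda>x. speed f \<gamma> (m *\<^sub>R x + c)) has_integral (1 / \<bar>m\<bar>) *\<^sub>R I)
          ((\<lambda>x. (1 / m) *\<^sub>R x + - ((1 / m) *\<^sub>R c)) ` {0..1})"
    using has_integral_affinity[of "speed f \<gamma>" I 0 1 m c] I \<open>m \<noteq> 0\<close> by simp
  also have "(\<lambda>x. (1 / m) *\<^sub>R x + - ((1 / m) *\<^sub>R c)) ` {0..1} = {a..b}"
    by (simp add: ab diff_divide_distrib)
  finally have "((\<lambda>x. \<bar>m\<bar> * speed f \<gamma> (m * x + c)) has_integral \<bar>m\<bar> * (1 / \<bar>m\<bar> * I)) {a..b}"
    by (intro has_integral_mult_right) simp
  then have *: "((\<lambda>x. \<bar>m\<bar> * speed f \<gamma> (m * x + c)) has_integral I) {a..b}"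
    using \<open>m \<noteq> 0\<close> by simp
  show ?thesis
  proof (rule has_integral_spike_finite[OF _ _ *])
    \<comment> \<open>Two kinds of parameters are discarded: the endpoints, where agreement with the
      reparametrized \<open>\<gamma>\<close> is not assumed on a full neighbourhood, and the
      preimages of the exceptional parameters of \<open>\<gamma>\<close>.\<close>
    show "finite ({a, b} \<union> (\<lambda>x. (x - c) / m) ` S)"
      using S(1) by simp
    fix t assume t: "t \<in> {a..b} - ({a, b} \<union> (\<lambda>x. (x - c) / m) ` S)"
    have "m * t + c \<in> {0..1}"
      using t \<open>m \<noteq> 0\<close> unfolding ab by auto
    moreover have "m * t + c \<notin> S"
    proof
      assume "m * t + c \<in> S"
      moreover have "t = (m * t + c - c) / m"
        using \<open>m \<noteq> 0\<close> by simp
      ultimately show False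
        using t by blast
    qed
    ultimately have "\<gamma> differentiable at (m * t + c)"
      using S(2) by blast
    then show "speed f \<delta> t = \<bar>m\<bar> * speed f \<gamma> (m * t + c)"
      using t \<delta> by (intro speed_affine[OF f, where S = "{a<..<b}"]) auto
  qed
qed

lemma has_integral_speed_joinpaths:
  assumes f: "\<And>z. f differentiable at z"
    and "valid_path \<gamma>" "valid_path \<delta>"
    and "(speed f \<gamma> has_integral I) {0..1}" "(speed f \<delta> has_integral J) {0..1}"
  shows "(speed f (\<gamma> +++ \<delta>) has_integral I + J) {0..1}"
proof (rule has_integral_combine)
  have "{0..1/2} = (\<lambda>x::real. (x - 0) / 2) ` {0..1}"
    by (simp add: image_divide_atLeastAtMost)
  then show "(speed f (\<gamma> +++ \<delta>) has_integral I) {0..1/2}"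
    by (rule has_integral_speed_affine[OF f assms(2,4), of 2, rotated]) (auto simp: joinpaths_def)
  have "{1/2..1} = (\<lambda>x::real. (x - (-1)) / 2) ` {0..1}"
    using image_affinity_atLeastAtMost[of "1/2" "1/2" 0 "1::real"]
    by (simp add: field_simps)
  then show "(speed f (\<gamma> +++ \<delta>) has_integral J) {1/2..1}"
    by (rule has_integral_speed_affine[OF f assms(3,5), of 2, rotated]) (auto simp: joinpaths_def)
qed auto

lemma has_integral_speed_reversepath:
  assumes f: "\<And>z. f differentiable at z"
    and "valid_path \<gamma>" "(speed f \<gamma> has_integral I) {0..1}"
  shows "(speed f (reversepath \<gamma>) has_integral I) {0..1}"
proof -
  have "{0..1} = (\<lambda>x::real. (x - 1) / (-1)) ` {0..1}"
    using image_affinity_atLeastAtMost[of "-1" "1" 0 "1::real"] by simp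
  then show ?thesis
    by (rule has_integral_speed_affine[OF f assms(2,3), of "-1", rotated]) (auto simp: reversepath_def)
qed

lemma induced_length_nonneg: "0 \<le> induced_length f \<gamma>"
  unfolding induced_length_def
  \<comment> \<open>Without integrability the integral has the default value 0.\<close>
  by (cases "speed f \<gamma> integrable_on {0..1}")
     (simp_all add: integral_nonneg not_integrable_integral speed_def)

text \<open>The fundamental theorem of calculus writes the displacement as the integral of the
  velocity of \<open>f \<circ> \<gamma>\<close>, whose norm is the speed.\<close>

lemma norm_diff_le_induced_length:
  fixes f :: "complex \<Rightarrow> real ^ 'n"
  assumes f: "\<And>z. f differentiable at z"
    and "valid_path \<gamma>" "speed f \<gamma> integrable_on {0..1}"
  shows "norm (f (pathfinish \<gamma>) - f (pathstart \<gamma>)) \<le> induced_length f \<gamma>"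
proof -
  obtain S where S: "finite S" "\<And>t. t \<in> {0..1} - S \<Longrightarrow> \<gamma> differentiable at t"
    using valid_path_differentiable[OF assms(2)] by metis
  define v where "v t = frechet_derivative f (at (\<gamma> t)) (vector_derivative \<gamma> (at t))" for t
  have "(v has_integral (f \<circ> \<gamma>) 1 - (f \<circ> \<gamma>) 0) {0..1}"
  proof (rule fundamental_theorem_of_calculus_interior_strong[OF S(1)])
    fix t :: real assume "t \<in> {0<..<1} - S"
    then have "(\<gamma> has_derivative (\<lambda>s. s *\<^sub>R vector_derivative \<gamma> (at t))) (at t)"
      using S(2)[of t] by (simp add: vector_derivative_works has_vector_derivative_def)
    from diff_chain_at[OF this, of f "frechet_derivative f (at (\<gamma> t))"]
    show "(f \<circ> \<gamma> has_vector_derivative v t) (at t)"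
      using f linear_frechet_derivative[OF f]
      by (simp add: has_vector_derivative_def v_def o_def linear_scale frechet_derivative_works[symmetric])
  next
    have "continuous_on UNIV f"
      using f by (simp add: continuous_on_eq_continuous_at differentiable_imp_continuous_within)
    then show "continuous_on {0..1} (f \<circ> \<gamma>)"
      using valid_path_imp_path[OF assms(2)] unfolding path_def
      by (blast intro: continuous_on_compose continuous_on_subset)
  qed simp
  then have "norm ((f \<circ> \<gamma>) 1 - (f \<circ> \<gamma>) 0) \<le> integral {0..1} (speed f \<gamma>)"
    using integral_norm_bound_integral[of v "{0..1}" "speed f \<gamma>"] assms(3)
    by (auto simp: has_integral_iff speed_def v_def)
  then show ?thesis
    by (simp add: induced_length_def pathstart_def pathfinish_def)
qed

section \<open>The induced distance of a continuously differentiable map\<close>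

context
  fixes f :: "complex \<Rightarrow> real ^ 'n"
  assumes C1: "Ck 1 f"
begin

lemma C1_differentiable: "f differentiable at z"
  using C1 by simp

lemma C1_continuous: "continuous_on A f"
  using C1_differentiable
  by (simp add: continuous_at_imp_continuous_on differentiable_imp_continuous_within)

text \<open>\<open>Ck\<close> gives continuity of the derivative only in each fixed direction.
  Expanding \<open>v\<close> in the basis \<open>1\<close>, \<open>\<i>\<close> turns this into an
  operator bound that depends continuously on \<open>z\<close>.\<close>

lemma norm_frechet_derivative_le:
  "norm (frechet_derivative f (at z) v) \<le>
    (norm (frechet_derivative f (at z) 1) + norm (frechet_derivative f (at z) \<i>)) * norm v"
proof -
  let ?D = "frechet_derivative f (at z)"
  have D: "linear ?D"
    by (rule linear_frechet_derivative[OF C1_differentiable])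
  have v: "Re v *\<^sub>R 1 + Im v *\<^sub>R \<i> = v"
    by (simp add: complex_eq_iff)
  have "?D v = Re v *\<^sub>R ?D 1 + Im v *\<^sub>R ?D \<i>"
    using linear_add[OF D, of "Re v *\<^sub>R 1" "Im v *\<^sub>R \<i>"] by (simp only: v linear_scale[OF D])
  then have "norm (?D v) \<le> \<bar>Re v\<bar> * norm (?D 1) + \<bar>Im v\<bar> * norm (?D \<i>)"
    by (metis norm_scaleR norm_triangle_ineq)
  also have "\<dots> \<le> norm v * norm (?D 1) + norm v * norm (?D \<i>)"
    by (intro add_mono mult_right_mono) (auto simp: abs_Re_le_cmod abs_Im_le_cmod)
  finally show ?thesis
    by (simp add: algebra_simps)
qed

lemma speed_linepath_integrable: "speed f (linepath p q) integrable_on {0..1}"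
proof -
  have "continuous_on UNIV (\<lambda>z. frechet_derivative f (at z) (q - p))"
    using C1 by simp
  then have "continuous_on {0..1} (\<lambda>t. norm (frechet_derivative f (at (linepath p q t)) (q - p)))"
    by (intro continuous_on_norm) (rule continuous_on_compose2[OF _ continuous_on_linepath subset_UNIV])
  then show ?thesis
    by (simp add: speed_def[abs_def] integrable_continuous_interval)
qed

lemma induced_dist_le_length:
  assumes "valid_path \<gamma>" "speed f \<gamma> integrable_on {0..1}"
  shows "induced_dist f (pathstart \<gamma>) (pathfinish \<gamma>) \<le> induced_length f \<gamma>"
  unfolding induced_dist_def
proof (rule cInf_lower)
  show "bdd_below {induced_length f \<gamma>' |\<gamma>'. valid_path \<gamma>' \<and> pathstart \<gamma>' = pathstart \<gamma> \<and>
      pathfinish \<gamma>' = pathfinish \<gamma> \<and> speed f \<gamma>' integrable_on {0..1}}"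
    using induced_length_nonneg by (intro bdd_belowI[of _ 0]) blast
qed (use assms in blast)

lemma induced_dist_approx:
  assumes "e > 0"
  obtains \<gamma> where "valid_path \<gamma>" "pathstart \<gamma> = p" "pathfinish \<gamma> = q"
    "speed f \<gamma> integrable_on {0..1}" "induced_length f \<gamma> < induced_dist f p q + e"
proof -
  let ?L = "{induced_length f \<gamma> |\<gamma>. valid_path \<gamma> \<and> pathstart \<gamma> = p \<and> pathfinish \<gamma> = q \<and>
    speed f \<gamma> integrable_on {0..1}}"
  \<comment> \<open>The segment makes the set nonempty, so its infimum can be approximated.\<close>
  have "induced_length f (linepath p q) \<in> ?L"
    using speed_linepath_integrable by force
  then have "\<exists>x\<in>?L. x < induced_dist f p q + e"
    using cInf_lessD[of ?L "induced_dist f p q + e"] assms unfolding induced_dist_def by force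
  then show ?thesis
    using that by blast
qed

lemma norm_diff_le_induced_dist: "norm (f q - f p) \<le> induced_dist f p q"
proof (rule field_le_epsilon)
  fix e :: real assume "e > 0"
  then obtain \<gamma> where "valid_path \<gamma>" "pathstart \<gamma> = p" "pathfinish \<gamma> = q"
    "speed f \<gamma> integrable_on {0..1}" "induced_length f \<gamma> < induced_dist f p q + e"
    by (rule induced_dist_approx)
  then show "norm (f q - f p) \<le> induced_dist f p q + e"
    using norm_diff_le_induced_length[OF C1_differentiable, of \<gamma>] by simp
qed

lemma induced_dist_refl: "induced_dist f p p = 0"
proof -
  have "induced_length f (linepath p p) = 0"
    using linear_0[OF linear_frechet_derivative[OF C1_differentiable]]
    by (simp add: induced_length_def speed_def[abs_def] linepath_refl)
  then have "induced_dist f p p \<le> 0"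
    using induced_dist_le_length[of "linepath p p"] speed_linepath_integrable by simp
  then show ?thesis
    using norm_diff_le_induced_dist[of p p] by simp
qed

lemma induced_dist_le_sym: "induced_dist f p q \<le> induced_dist f q p"
proof (rule field_le_epsilon)
  fix e :: real assume "e > 0"
  then obtain \<gamma> where \<gamma>: "valid_path \<gamma>" "pathstart \<gamma> = q" "pathfinish \<gamma> = p"
    "speed f \<gamma> integrable_on {0..1}" "induced_length f \<gamma> < induced_dist f q p + e"
    by (rule induced_dist_approx)
  have "(speed f (reversepath \<gamma>) has_integral induced_length f \<gamma>) {0..1}"
    using \<gamma> unfolding induced_length_def
    by (intro has_integral_speed_reversepath[OF C1_differentiable] integrable_integral)
  then show "induced_dist f p q \<le> induced_dist f q p + e"
    using \<gamma> induced_dist_le_length[of "reversepath \<gamma>"]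
    by (force simp: has_integral_iff induced_length_def)
qed

lemma induced_dist_triangle: "induced_dist f p r \<le> induced_dist f p q + induced_dist f q r"
proof (rule field_le_epsilon)
  fix e :: real assume "e > 0"
  then have e: "e / 2 > 0" by simp
  obtain \<gamma> where \<gamma>: "valid_path \<gamma>" "pathstart \<gamma> = p" "pathfinish \<gamma> = q"
    "speed f \<gamma> integrable_on {0..1}" "induced_length f \<gamma> < induced_dist f p q + e / 2"
    by (rule induced_dist_approx[OF e])
  obtain \<delta> where \<delta>: "valid_path \<delta>" "pathstart \<delta> = q" "pathfinish \<delta> = r"
    "speed f \<delta> integrable_on {0..1}" "induced_length f \<delta> < induced_dist f q r + e / 2"
    by (rule induced_dist_approx[OF e])
  have "(speed f (\<gamma> +++ \<delta>) has_integral induced_length f \<gamma> + induced_length f \<delta>) {0..1}"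
    using \<gamma> \<delta> unfolding induced_length_def
    by (intro has_integral_speed_joinpaths[OF C1_differentiable] integrable_integral)
  then show "induced_dist f p r \<le> induced_dist f p q + induced_dist f q r + e"
    using \<gamma> \<delta> induced_dist_le_length[of "\<gamma> +++ \<delta>"] valid_path_join[of \<gamma> \<delta>]
    by (force simp: has_integral_iff induced_length_def)
qed

text \<open>By convexity the segment from \<open>p\<close> to \<open>q\<close> stays in the ball,
  where the operator bound \<open>k\<close> has a maximum by compactness. Hence Euclidean
  convergence implies convergence in the induced distance.\<close>

lemma induced_dist_le_on_cball:
  assumes "R \<ge> 0"
  obtains B where "\<And>p q. p \<in> cball z R \<Longrightarrow> q \<in> cball z R \<Longrightarrow> induced_dist f p q \<le> B * dist p q"
proof -
  define k where "k w = norm (frechet_derivative f (at w) 1) + norm (frechet_derivative f (at w) \<i>)" for w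
  have "continuous_on UNIV (\<lambda>w. frechet_derivative f (at w) v)" for v
    using C1 by simp
  then have "continuous_on (cball z R) k"
    unfolding k_def by (intro continuous_intros) (auto intro: continuous_on_subset)
  then obtain w where B: "\<And>y. y \<in> cball z R \<Longrightarrow> k y \<le> k w"
    using continuous_attains_sup[of "cball z R" k] assms by (metis cball_eq_empty compact_cball not_less)
  have "induced_dist f p q \<le> k w * dist p q" if p: "p \<in> cball z R" and q: "q \<in> cball z R" for p q
  proof -
    have "induced_dist f p q \<le> induced_length f (linepath p q)"
      using induced_dist_le_length[of "linepath p q"] speed_linepath_integrable by simp
    also have "\<dots> \<le> integral {0..1} (\<lambda>t::real. k w * dist p q)"
      unfolding induced_length_def
    proof (rule integral_le[OF speed_linepath_integrable])
      fix t :: real assume "t \<in> {0..1}"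
      then have "linepath p q t \<in> closed_segment p q"
        by (simp add: linepath_in_path)
      also have "\<dots> \<subseteq> cball z R"
        using closed_segment_subset[OF p q convex_cball] .
      finally have "k (linepath p q t) \<le> k w"
        by (rule B)
      then have "k (linepath p q t) * norm (q - p) \<le> k w * norm (q - p)"
        by (intro mult_right_mono) auto
      then show "speed f (linepath p q) t \<le> k w * dist p q"
        using norm_frechet_derivative_le[of "linepath p q t" "q - p"]
        by (simp add: speed_def k_def dist_norm norm_minus_commute)
    qed auto
    finally show ?thesis
      by simp
  qed
  then show ?thesis
    using that by blast
qed

end

text \<open>The induced distance dominates the distance of the images, so a Cauchy sequence has bounded
  image and by properness stays in a compact set, where the induced distance is dominated by the
  Euclidean one.\<close>

theorem properly_embedded_imp_complete:
  fixes f :: "complex \<Rightarrow> real ^ 'n"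
  assumes "properly_embedded f"
  shows "complete_surface f"
proof -
  have C1: "Ck 1 f" and inj: "inj f" and proper: "proper_map euclidean euclidean f"
    using assms unfolding properly_embedded_def immersion_def by blast+
  interpret M: Metric_space UNIV "induced_dist f"
  proof
    fix p q r
    show "0 \<le> induced_dist f p q"
      using norm_diff_le_induced_dist[OF C1] norm_ge_zero by (rule order_trans[rotated])
    show "induced_dist f p q = induced_dist f q p"
      using induced_dist_le_sym[OF C1] by (rule antisym) (rule induced_dist_le_sym[OF C1])
    \<comment> \<open>Distance 0 forces equal images under \<open>f\<close>, and injectivity then
      gives \<open>p = q\<close>.\<close>
    show "induced_dist f p q = 0 \<longleftrightarrow> p = q"
      using norm_diff_le_induced_dist[OF C1, of q p] induced_dist_refl[OF C1] inj
      by (auto simp: inj_eq)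
    show "induced_dist f p r \<le> induced_dist f p q + induced_dist f q r"
      by (rule induced_dist_triangle[OF C1])
  qed
  have "\<exists>x. limitin M.mtopology \<sigma> x sequentially" if \<sigma>: "M.MCauchy \<sigma>" for \<sigma>
  proof -
    have "Cauchy (f \<circ> \<sigma>)"
      unfolding Cauchy_def
    proof (intro allI impI)
      fix e :: real assume "e > 0"
      then obtain N where "\<And>m n. N \<le> m \<Longrightarrow> N \<le> n \<Longrightarrow> induced_dist f (\<sigma> m) (\<sigma> n) < e"
        using \<sigma> unfolding M.MCauchy_def by blast
      moreover have "dist ((f \<circ> \<sigma>) m) ((f \<circ> \<sigma>) n) \<le> induced_dist f (\<sigma> m) (\<sigma> n)" for m n
        using norm_diff_le_induced_dist[OF C1] by (metis comp_apply dist_norm dist_commute)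
      ultimately show "\<exists>M. \<forall>m\<ge>M. \<forall>n\<ge>M. dist ((f \<circ> \<sigma>) m) ((f \<circ> \<sigma>) n) < e"
        by (meson order_le_less_trans)
    qed
    then have "bounded (range (f \<circ> \<sigma>))"
      by (rule cauchy_imp_bounded)
    then have "compact (closure (range (f \<circ> \<sigma>)))"
      by (simp add: compact_closure)
    then have "compact (f -` closure (range (f \<circ> \<sigma>)))"
      using proper proper_map_iff_compact_vimage[OF C1_continuous[OF C1]] by blast
    moreover have "\<sigma> n \<in> f -` closure (range (f \<circ> \<sigma>))" for n
      using closure_subset[of "range (f \<circ> \<sigma>)"] by auto
    ultimately obtain x r where r: "strict_mono r" and x: "(\<sigma> \<circ> r) \<longlonglongrightarrow> x"
      unfolding compact_def by blast
    obtain B where B: "\<And>p q. p \<in> cball x 1 \<Longrightarrow> q \<in> cball x 1 \<Longrightarrow> induced_dist f p q \<le> B * dist p q"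
      using induced_dist_le_on_cball[OF C1, of 1] by auto
    have "eventually (\<lambda>n. dist ((\<sigma> \<circ> r) n) x < 1) sequentially"
      using x by (rule tendstoD) simp
    then have "eventually (\<lambda>n. induced_dist f ((\<sigma> \<circ> r) n) x \<le> B * dist ((\<sigma> \<circ> r) n) x) sequentially"
      by (rule eventually_mono) (intro B; simp add: dist_commute)
    moreover have "(\<lambda>n. B * dist ((\<sigma> \<circ> r) n) x) \<longlonglongrightarrow> 0"
      using tendsto_mult_right_zero[OF tendsto_dist_iff[THEN iffD1, OF x]] .
    ultimately have "(\<lambda>n. induced_dist f ((\<sigma> \<circ> r) n) x) \<longlonglongrightarrow> 0"
      using Lim_null_comparison[of "\<lambda>n. induced_dist f ((\<sigma> \<circ> r) n) x"] by simp
    then have "limitin M.mtopology (\<sigma> \<circ> r) x sequentially"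
      by (simp add: M.limitin_metric_dist_null)
    then show ?thesis
      using M.MCauchy_convergent_subsequence[OF \<sigma> r] by blast
  qed
  then show ?thesis
    unfolding complete_surface_def M.mcomplete_def using M.Metric_space_axioms by blast
qed

subsection \<open>The surface along a hyperbola\<close>

text \<open>On the branch \<open>x > 0\<close> or \<open>x < 0\<close> of the hyperbola \<open>x y = c\<close> the second and third coordinate of
  the surface are \<^term>\<open>curve_g k x\<close> and \<^term>\<open>- c * curve_h k x\<close> with \<open>k = c\<^sup>2\<close>.\<close>

definition curve_g :: "real \<Rightarrow> real \<Rightarrow> real" where
  "curve_g k x = x ^ 3 / 3 - k / x + x / 2"

definition curve_h :: "real \<Rightarrow> real \<Rightarrow> real" where
  "curve_h k x = x ^ 3 - 2 * k / x + k\<^sup>2 / (5 * x ^ 5) + 1 / x"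

lemma curve_g_less:
  assumes "k > 0" "0 < x" "x < y"
  shows "curve_g k x < curve_g k y"
proof -
  have "k / y < k / x" "x ^ 3 < y ^ 3"
    using assms by (auto intro: divide_strict_left_mono power_strict_mono)
  then show ?thesis
    using assms by (simp add: curve_g_def)
qed


lemma curve_g_minus: "curve_g k (- x) = - curve_g k x"
  and curve_h_minus: "curve_h k (- x) = - curve_h k x"
  by (simp_all add: curve_g_def curve_h_def)

lemma curve_g_root:
  assumes "k > 0"
  obtains x where "x > 0" "curve_g k x = 0" "k = x ^ 4 / 3 + x\<^sup>2 / 2"
proof -
  let ?p = "\<lambda>x::real. x ^ 4 / 3 + x\<^sup>2 / 2"
  \<comment> \<open>For \<open>x > 0\<close>, \<open>x * curve_g k x = ?p x - k\<close>, so a zero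
    of \<open>curve_g k\<close> is a solution of \<open>?p x = k\<close>. The point
    \<open>k + 1\<close> is an upper end for the intermediate value theorem.\<close>
  have "k \<le> (k + 1)\<^sup>2 / 2" "0 \<le> (k + 1) ^ 4 / 3"
    by (simp_all add: power2_sum)
  then have "?p 0 \<le> k" "k \<le> ?p (k + 1)"
    using assms by (simp, linarith)
  moreover have "continuous_on {0..k + 1} ?p"
    by (intro continuous_intros) auto
  ultimately obtain x where x: "0 \<le> x" "?p x = k"
    using IVT'[of ?p 0 k "k + 1"] assms by auto
  then have "x \<noteq> 0"
    using assms by auto
  have "curve_g k x = 0"
    using \<open>x \<noteq> 0\<close> unfolding curve_g_def x(2)[symmetric] by (simp add: field_simps eval_nat_numeral)
  then show ?thesis
    using x \<open>x \<noteq> 0\<close> by (intro that[of x]) (simp_all only: less_le not_sym simp_thms)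
qed

text \<open>The hypothesis on \<open>k\<close> says that \<open>curve_g k x = 0\<close>. Eliminating
  \<open>k\<close> turns \<open>x * curve_h k x\<close> into the quadratic
  \<open>16/45 * X^2 - 14/15 * X + 21/20\<close> in \<open>X = x^2\<close>, which is positive by
  completing the square.\<close>

lemma curve_h_pos:
  assumes "x > 0" and k: "k = x ^ 4 / 3 + x\<^sup>2 / 2"
  shows "curve_h k x > 0"
proof -
  have "curve_h k x = (16/45 * (x\<^sup>2 - 21/16)\<^sup>2 + 7/16) / x"
    using assms(1) unfolding curve_h_def k by (simp add: field_simps eval_nat_numeral)
  moreover have "16/45 * (x\<^sup>2 - 21/16)\<^sup>2 + 7/16 > (0::real)"
    by (intro add_nonneg_pos) auto
  ultimately show ?thesis
    using assms(1) by simp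
qed

text \<open>With \<open>X = x\<^sup>2\<close>, the quotient \<open>N X / D X\<close> is the slope \<open>dh/dg\<close> along the hyperbola.\<close>

lemma slope_mono:
  fixes k X Y :: real
  defines "N \<equiv> \<lambda>X. 3 * X\<^sup>2 + 2 * k - 1 - k\<^sup>2 / X\<^sup>2"
    and "D \<equiv> \<lambda>X. X\<^sup>2 + X / 2 + k"
  assumes "k > 0" "0 < X" "X \<le> Y"
  shows "N X / D X \<le> N Y / D Y"
proof -
  define P where "P = X * Y"
  \<comment> \<open>\<open>E\<close> is the quotient of \<open>N Y * D X - N X * D Y\<close> by
    \<open>Y - X\<close>. Its only possibly negative part is absorbed by a square: splitting
    \<open>(X^2 + X*Y + Y^2)/2\<close> as \<open>(X - Y)^2/2 + 3/2 * P\<close> releases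
    \<open>3/2 * k^2/P\<close>, which joins \<open>3/2 * P - k\<close> to give
    \<open>3/2 * (P - k)^2/P + 2 * k\<close>. \<open>R\<close> is the rest of the contribution of
    \<open>- k^2/X^2\<close>.\<close>
  define R where "R = k\<^sup>2 / P\<^sup>2 * ((X + Y) * (X\<^sup>2 + Y\<^sup>2) + (X - Y)\<^sup>2 / 2 + k * (X + Y))"
  define E where "E = k * (X + Y) + (X + Y) + 1 / 2 + 3/2 * ((P - k)\<^sup>2 / P) + 2 * k + R"
  have pos: "X > 0" "Y > 0" "P > 0"
    using assms by (auto simp: P_def)
  have "R \<ge> 0"
    using pos assms unfolding R_def by (intro mult_nonneg_nonneg add_nonneg_nonneg) auto
  then have "E \<ge> 0"
    using pos assms unfolding E_def by (intro add_nonneg_nonneg) auto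
  moreover have "N Y * D X - N X * D Y = (Y - X) * E"
    using pos(1,2) unfolding N_def D_def E_def R_def P_def
    by (simp add: divide_simps) algebra
  ultimately have "N X * D Y \<le> N Y * D X"
    using \<open>X \<le> Y\<close> by (smt (verit) mult_nonneg_nonneg)
  moreover have "D Z > 0" if "Z > 0" for Z
    using that \<open>k > 0\<close> unfolding D_def by (intro add_pos_pos) auto
  ultimately show ?thesis
    using pos(1,2) by (simp add: divide_simps mult.commute)
qed

text \<open>For fixed \<open>k\<close>, \<^const>\<open>curve_h\<close> is a convex function of \<^const>\<open>curve_g\<close>, and \<open>m\<close> is its slope
  at \<open>x0\<close>.\<close>

lemma curve_h_tangent:
  assumes "k > 0" "x0 > 0"
  obtains m where
    "\<And>x. x > 0 \<Longrightarrow> curve_h k x0 + m * (curve_g k x - curve_g k x0) \<le> curve_h k x"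
proof -
  define N where "N X = 3 * X\<^sup>2 + 2 * k - 1 - k\<^sup>2 / X\<^sup>2" for X :: real
  define D where "D X = X\<^sup>2 + X / 2 + k" for X :: real
  define q where "q x = N (x\<^sup>2) / D (x\<^sup>2)" for x
  define m where "m = q x0"
  \<comment> \<open>The derivatives of \<open>curve_g k\<close> and \<open>curve_h k\<close> at
    \<open>x\<close> are \<open>D (x^2) / x^2\<close> and \<open>N (x^2) / x^2\<close>, so that of
    \<open>\<psi>\<close> is the former, which is nonnegative, times \<open>q x - m\<close>. As
    \<open>q\<close> is monotone, \<open>\<psi>\<close> falls up to \<open>x0\<close> and rises
    after it.\<close>
  define \<psi> where "\<psi> x = curve_h k x - m * curve_g k x" for x
  have q_mono: "q x \<le> q y" if "0 < x" "x \<le> y" for x y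
    using slope_mono[of k "x\<^sup>2" "y\<^sup>2"] that assms unfolding q_def N_def D_def by (simp add: power_mono)
  have D: "(\<psi> has_real_derivative D (x\<^sup>2) / x\<^sup>2 * (q x - m)) (at x)" if "x > 0" for x
  proof -
    have "D (x\<^sup>2) > 0"
      using assms unfolding D_def by (intro add_nonneg_pos) auto
    then have "D (x\<^sup>2) / x\<^sup>2 * (q x - m) = N (x\<^sup>2) / x\<^sup>2 - m * (D (x\<^sup>2) / x\<^sup>2)"
      by (simp add: q_def algebra_simps)
    moreover have "N (x\<^sup>2) / x\<^sup>2 = 3 * x\<^sup>2 + 2 * k / x\<^sup>2 - k\<^sup>2 / x ^ 6 - 1 / x\<^sup>2"
      using that unfolding N_def by (simp add: divide_simps eval_nat_numeral) algebra
    moreover have "D (x\<^sup>2) / x\<^sup>2 = x\<^sup>2 + k / x\<^sup>2 + 1 / 2"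
      using that unfolding D_def by (simp add: divide_simps eval_nat_numeral)
    moreover have "(curve_h k has_real_derivative 3 * x\<^sup>2 + 2 * k / x\<^sup>2 - k\<^sup>2 / x ^ 6 - 1 / x\<^sup>2) (at x)"
      unfolding curve_h_def[abs_def] using that
      by (auto intro!: derivative_eq_intros) (simp add: divide_simps eval_nat_numeral)
    moreover have "(curve_g k has_real_derivative x\<^sup>2 + k / x\<^sup>2 + 1 / 2) (at x)"
      unfolding curve_g_def[abs_def] using that
      by (auto intro!: derivative_eq_intros) (simp add: divide_simps eval_nat_numeral)
    ultimately show ?thesis
      unfolding \<psi>_def[abs_def] by (auto intro!: derivative_eq_intros)
  qed
  have D_nonneg: "D (x\<^sup>2) / x\<^sup>2 \<ge> 0" for x
    using assms unfolding D_def by (intro divide_nonneg_nonneg add_nonneg_nonneg) auto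
  have "\<psi> x0 \<le> \<psi> x" if "x > 0" for x
  proof (cases "x0 \<le> x")
    case True
    show ?thesis
    proof (rule DERIV_nonneg_imp_nondecreasing[OF True])
      fix y assume "x0 \<le> y"
      then show "\<exists>d. (\<psi> has_real_derivative d) (at y) \<and> 0 \<le> d"
        using q_mono[of x0 y] assms
        by (intro exI[of _ "D (y\<^sup>2) / y\<^sup>2 * (q y - m)"] conjI D mult_nonneg_nonneg D_nonneg)
           (simp_all add: m_def)
    qed
  next
    case False
    then have "x \<le> x0" by simp
    then show ?thesis
    proof (rule DERIV_nonpos_imp_nonincreasing)
      fix y assume "x \<le> y" "y \<le> x0"
      then show "\<exists>d. (\<psi> has_real_derivative d) (at y) \<and> d \<le> 0"
        using q_mono[of y x0] that
        by (intro exI[of _ "D (y\<^sup>2) / y\<^sup>2 * (q y - m)"] conjI D mult_nonneg_nonpos D_nonneg)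
           (simp_all add: m_def)
    qed
  qed
  then show ?thesis
    using that[of m] by (auto simp: \<psi>_def algebra_simps)
qed

text \<open>The tangent inequality at the zero \<open>x0\<close> of \<open>curve_g k\<close> is
  applied at \<open>x\<close> and at \<open>y\<close>. The slope terms cancel in the sum, which
  leaves the positive lower bound \<open>2 * curve_h k x0\<close>.\<close>

lemma curve_h_add_pos:
  assumes "k > 0" "x > 0" "y > 0" and sum: "curve_g k x + curve_g k y = 0"
  shows "curve_h k x + curve_h k y > 0"
proof -
  obtain x0 where x0: "x0 > 0" "curve_g k x0 = 0" "k = x0 ^ 4 / 3 + x0\<^sup>2 / 2"
    by (rule curve_g_root[OF \<open>k > 0\<close>])
  obtain m where m: "\<And>x. x > 0 \<Longrightarrow> curve_h k x0 + m * (curve_g k x - curve_g k x0) \<le> curve_h k x"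
    using curve_h_tangent[OF \<open>k > 0\<close> \<open>x0 > 0\<close>] by blast
  have "2 * curve_h k x0 + m * (curve_g k x + curve_g k y) \<le> curve_h k x + curve_h k y"
    using m[OF \<open>x > 0\<close>] m[OF \<open>y > 0\<close>] x0(2) by (simp add: algebra_simps)
  then show ?thesis
    using curve_h_pos[OF x0(1,3)] sum by simp
qed

section \<open>Injectivity and properness in real coordinates\<close>

definition coord2 :: "real \<Rightarrow> real \<Rightarrow> real" where
  "coord2 x y = x ^ 3 / 3 - x * y\<^sup>2 + x / 2"

definition coord3 :: "real \<Rightarrow> real \<Rightarrow> real" where
  "coord3 x y = y * (x ^ 4 - 2 * (x * y)\<^sup>2 + y ^ 4 / 5 + 1)"

lemma coords_curve:
  assumes "x \<noteq> 0"
  shows "coord2 x y = curve_g ((x * y)\<^sup>2) x" "coord3 x y = x * y * curve_h ((x * y)\<^sup>2) x"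
proof -
  have "(x * y)\<^sup>2 / x = x * y\<^sup>2"
    using assms by (simp add: power2_eq_square)
  then show "coord2 x y = curve_g ((x * y)\<^sup>2) x"
    by (simp add: coord2_def curve_g_def)
  have "x * curve_h k x = x ^ 4 - 2 * k + (k / x\<^sup>2)\<^sup>2 / 5 + 1" for k
    using assms unfolding curve_h_def by (simp add: field_simps eval_nat_numeral)
  moreover have "((x * y)\<^sup>2 / x\<^sup>2)\<^sup>2 = y ^ 4"
    using assms by (simp add: power_mult_distrib flip: power_mult)
  ultimately show "coord3 x y = x * y * curve_h ((x * y)\<^sup>2) x"
    by (simp add: coord3_def mult.commute mult.left_commute)
qed

lemma coords_unique:
  assumes 1: "x * y = u * v" and 2: "coord2 x y = coord2 u v" and 3: "coord3 x y = coord3 u v"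
  shows "x = u \<and> y = v"
proof (cases "x * y = 0")
  case True
  \<comment> \<open>If \<open>x * y = 0\<close>, both points lie on the coordinate axes, where
    \<open>coord2\<close> and \<open>coord3\<close> reduce to 0 or to these strictly increasing
    polynomials. For points on different axes, \<open>zero\<close> puts both on the axis
    \<open>x = 0\<close>.\<close>
  have inc2: "a = b" if "a ^ 3 / 3 + a / 2 = b ^ 3 / 3 + b / 2" for a b :: real
    using that power_mono_odd[of 3 a b] power_mono_odd[of 3 b a]
    by (cases a b rule: linorder_cases) auto
  have inc3: "a = b" if "a * (a ^ 4 / 5 + 1) = b * (b ^ 4 / 5 + 1)" for a b :: real
  proof -
    have "a ^ 5 / 5 + a = b ^ 5 / 5 + b"
      using that by (simp add: algebra_simps eval_nat_numeral)
    then show ?thesis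
      using power_mono_odd[of 5 a b] power_mono_odd[of 5 b a]
      by (cases a b rule: linorder_cases) auto
  qed
  have zero: "b = 0" if "b ^ 3 / 3 + b / 2 = 0" for b :: real
    using inc2[of b 0] that by simp
  from True 1 have "x = 0 \<or> y = 0" "u = 0 \<or> v = 0"
    by auto
  then show ?thesis
    using 2 3 inc2[of x u] inc3[of y v] zero[of x] zero[of u]
    unfolding coord2_def coord3_def by auto
next
  case False
  define k where "k = (x * y)\<^sup>2"
  have nz: "x \<noteq> 0" "u \<noteq> 0" "k > 0"
    using False 1 by (auto simp: k_def)
  have g: "curve_g k x = curve_g k u"
    using 1 2 coords_curve(1)[OF nz(1), of y] coords_curve(1)[OF nz(2), of v] by (simp add: k_def)
  have h: "curve_h k x = curve_h k u"
    using 1 3 False coords_curve(2)[OF nz(1), of y] coords_curve(2)[OF nz(2), of v] by (simp add: k_def)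
  have inj: "a = b" if "0 < a" "0 < b" "curve_g k a = curve_g k b" for a b
    using that curve_g_less[OF nz(3)] by (metis linorder_less_linear order_less_irrefl)
  \<comment> \<open>On different branches, \<open>a\<close> and \<open>- b\<close> are positive with
    opposite values of \<open>curve_g k\<close> and of \<open>curve_h k\<close>, so both sums
    vanish, contrary to \<open>curve_h_add_pos\<close>.\<close>
  have opp: False if "0 < a" "b < 0" "curve_g k a = curve_g k b" "curve_h k a = curve_h k b" for a b
    using curve_h_add_pos[OF nz(3), of a "- b"] that by (simp add: curve_g_minus curve_h_minus)
  consider "0 < x" "0 < u" | "x < 0" "u < 0" | "0 < x" "u < 0" | "x < 0" "0 < u"
    using nz by linarith
  then have "x = u"
  proof cases
    case 1 then show ?thesis using inj g by blast
  next
    case 2 then show ?thesis using inj[of "- x" "- u"] g by (simp add: curve_g_minus)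
  next
    case 3 then show ?thesis using opp[of x u] g h by blast
  next
    case 4 then show ?thesis using opp[of u x] g h by simp
  qed
  then show ?thesis
    using 1 nz by simp
qed

text \<open>The mixed terms are controlled by the first coordinate: if
  \<open>\<bar>x\<bar> > 1\<close>, then
  \<open>\<bar>x * y^2\<bar> \<le> (x * y)^2 \<le> M^2\<close>, and \<open>coord2\<close> bounds
  \<open>x\<close>. If \<open>\<bar>y\<bar> > 1\<close>, the second factor of \<open>coord3\<close>
  is at most \<open>M\<close>, which bounds \<open>y^4\<close>. The summand 1 covers the remaining
  cases.\<close>

lemma coords_bounded:
  assumes M: "\<bar>x * y\<bar> \<le> M" "\<bar>coord2 x y\<bar> \<le> M" "\<bar>coord3 x y\<bar> \<le> M"
  shows "\<bar>x\<bar> \<le> 1 + 2 * M + 2 * M\<^sup>2" "\<bar>y\<bar> \<le> 1 + 5 * M + 10 * M\<^sup>2"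
proof -
  have "M \<ge> 0" using M(1) by linarith
  have sq: "(x * y)\<^sup>2 \<le> M\<^sup>2"
    using M(1) by (metis abs_ge_zero power2_abs power_mono)
  show "\<bar>x\<bar> \<le> 1 + 2 * M + 2 * M\<^sup>2"
  proof (cases "\<bar>x\<bar> \<le> 1")
    case False
    have "\<bar>x\<bar> * y\<^sup>2 \<le> \<bar>x\<bar> * (\<bar>x\<bar> * y\<^sup>2)"
      using False mult_right_mono[of 1 "\<bar>x\<bar>" "\<bar>x\<bar> * y\<^sup>2"] by simp
    also have "\<dots> = (x * y)\<^sup>2"
      by (simp add: power_mult_distrib power2_eq_square flip: abs_mult mult.assoc)
    also note sq
    finally have "\<bar>x * y\<^sup>2\<bar> \<le> M\<^sup>2" by (simp add: abs_mult)
    moreover have "\<bar>x ^ 3 / 3 + x / 2\<bar> = \<bar>x\<bar> ^ 3 / 3 + \<bar>x\<bar> / 2"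
    proof (cases "x \<ge> 0")
      case False
      then have "x ^ 3 \<le> 0" by (simp add: power_le_zero_eq)
      then have "\<bar>x ^ 3 / 3 + x / 2\<bar> = - (x ^ 3 / 3 + x / 2)"
        using False by (intro abs_of_nonpos) linarith
      then show ?thesis using False by simp
    qed simp
    moreover have "\<bar>x\<bar> ^ 3 \<ge> 0" by simp
    ultimately have "\<bar>x\<bar> / 2 \<le> M + M\<^sup>2"
      using M(2) unfolding coord2_def by linarith
    then show ?thesis by simp
  qed (use \<open>M \<ge> 0\<close> zero_le_power2[of M] in linarith)
  show "\<bar>y\<bar> \<le> 1 + 5 * M + 10 * M\<^sup>2"
  proof (cases "\<bar>y\<bar> \<le> 1")
    case False
    define s where "s = (x * y)\<^sup>2"
    let ?e = "x ^ 4 - 2 * s + y ^ 4 / 5 + 1"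
    have "\<bar>?e\<bar> \<le> \<bar>y\<bar> * \<bar>?e\<bar>"
      using False mult_right_mono[of 1 "\<bar>y\<bar>" "\<bar>?e\<bar>"] by simp
    also have "\<dots> \<le> M"
      using M(3) by (simp add: coord3_def abs_mult s_def)
    finally have "?e \<le> M" by simp
    moreover have "x ^ 4 \<ge> 0" by simp
    ultimately have "y ^ 4 / 5 \<le> M + 2 * s" by linarith
    then have "y ^ 4 / 5 \<le> M + 2 * M\<^sup>2"
      using sq unfolding s_def by linarith
    then have "y ^ 4 \<le> 5 * M + 10 * M\<^sup>2"
      by (simp add: field_simps)
    moreover have "\<bar>y\<bar> ^ 1 \<le> \<bar>y\<bar> ^ 4"
      using False by (intro power_increasing) auto
    ultimately show ?thesis by simp
  qed (use \<open>M \<ge> 0\<close> zero_le_power2[of M] in linarith)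
qed

subsection \<open>The surface\<close>

lemma harmonic_surface_primitive:
  fixes \<phi> \<Phi> :: "complex \<Rightarrow> complex ^ 3"
  assumes "\<And>k w. ((\<lambda>w. \<Phi> w $ k) has_field_derivative \<phi> w $ k) (at w)"
  shows "harmonic_surface \<phi> z0 z = (\<chi> k. Re (\<Phi> z $ k) - Re (\<Phi> z0 $ k))"
proof -
  have "contour_integral (linepath z0 z) (\<lambda>w. \<phi> w $ k) = \<Phi> z $ k - \<Phi> z0 $ k" for k
    using contour_integral_primitive[of UNIV "\<lambda>w. \<Phi> w $ k" "\<lambda>w. \<phi> w $ k" "linepath z0 z"] assms
    by (auto intro: contour_integral_unique)
  then show ?thesis
    by (simp add: harmonic_surface_def)
qed

lemma has_derivative_Re_vec:
  fixes \<Phi> :: "complex \<Rightarrow> complex ^ 'n"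
  assumes "\<And>k. ((\<lambda>w. \<Phi> w $ k) has_field_derivative d $ k) (at z)"
  shows "((\<lambda>z. \<chi> k. Re (\<Phi> z $ k) - c k) has_derivative (\<lambda>v. \<chi> k. Re (d $ k * v))) (at z)"
proof -
  have "((\<lambda>z. Re (\<Phi> z $ k) - c k) has_derivative (\<lambda>v. Re (d $ k * v))) (at z)" for k
  proof -
    have "((\<lambda>w. \<Phi> w $ k) has_derivative (\<lambda>v. d $ k * v)) (at z)"
      using assms by (simp add: has_field_derivative_def)
    then show ?thesis
      by (auto intro!: derivative_eq_intros)
  qed
  then show ?thesis
    by (subst has_derivative_componentwise_within) (auto simp: Basis_vec_def inner_axis)
qed

text \<open>The derivative in direction \<open>v\<close> is the real part of the holomorphic map
  with components \<open>d z $ k * v\<close>, so the class reproduces itself with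
  \<open>c = 0\<close>. The general \<open>c\<close> admits the base point values.\<close>

lemma Ck_Re_holomorphic:
  fixes \<Phi> :: "complex \<Rightarrow> complex ^ 'n"
  assumes "\<And>k. (\<lambda>w. \<Phi> w $ k) holomorphic_on UNIV"
  shows "Ck n (\<lambda>z. \<chi> k. Re (\<Phi> z $ k) - c k)"
  using assms
proof (induction n arbitrary: \<Phi> c)
  case 0
  then show ?case
    unfolding Ck.simps
    by (intro continuous_on_vec_lambda continuous_on_diff continuous_on_Re continuous_on_const
          holomorphic_on_imp_continuous_on)
next
  case (Suc n)
  let ?f = "\<lambda>z. \<chi> k. Re (\<Phi> z $ k) - c k"
  define d where "d z = (\<chi> k. deriv (\<lambda>w. \<Phi> w $ k) z)" for z
  have D: "(?f has_derivative (\<lambda>v. \<chi> k. Re (d z $ k * v))) (at z)" for z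
    using Suc.prems
    by (intro has_derivative_Re_vec) (simp add: d_def holomorphic_derivI[OF _ open_UNIV UNIV_I])
  have "Ck n (\<lambda>z. frechet_derivative ?f (at z) v)" for v
  proof -
    have "Ck n (\<lambda>z. \<chi> k. Re ((\<chi> k. d z $ k * v) $ k) - 0)"
      using Suc.prems by (intro Suc.IH) (auto simp: d_def intro!: holomorphic_intros)
    then show ?thesis
      by (simp add: frechet_derivative_at[OF D, symmetric])
  qed
  then show ?case
    using D by (auto simp: differentiable_def)
qed

section \<open>The primitive of the given forms\<close>

definition Omega :: "complex \<Rightarrow> complex \<Rightarrow> complex ^ 3" where
  "Omega a z = vector [\<i> * z\<^sup>2 / 2, z ^ 3 / 3 + a * z, \<i> * z ^ 5 / 5 + \<i> * z]"

lemma Omega_has_field_derivative: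
  "((\<lambda>z. Omega a z $ k) has_field_derivative omega a z $ k) (at z)"
proof -
  have "\<forall>k. ((\<lambda>z. Omega a z $ k) has_field_derivative omega a z $ k) (at z)"
    unfolding forall_3 Omega_def omega_def vector_3
    by (auto intro!: derivative_eq_intros simp: field_simps)
  then show ?thesis ..
qed

lemma harmonic_surface_omega:
  "harmonic_surface (omega a) z0 = (\<lambda>z. \<chi> k. Re (Omega a z $ k) - Re (Omega a z0 $ k))"
  using harmonic_surface_primitive[OF Omega_has_field_derivative] by blast

lemma Re_Omega:
  "Re (Omega (1/2) z $ 1) = - (Re z * Im z)"
  "Re (Omega (1/2) z $ 2) = coord2 (Re z) (Im z)"
  "Re (Omega (1/2) z $ 3) = - coord3 (Re z) (Im z)"
  unfolding Omega_def vector_3 coord2_def coord3_def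
  by (simp_all add: eval_nat_numeral field_simps)

text \<open>The first equation makes \<open>z * v\<close> real, so for \<open>z \<noteq> 0\<close> a
  nonzero \<open>v\<close> is a real multiple of \<open>cnj z\<close>. The second then forces
  \<open>Re z = 0\<close>, and on the imaginary axis the third forces \<open>Im z = 0\<close>. At
  \<open>z = 0\<close> the last two equations give \<open>v = 0\<close> directly.\<close>

lemma omega_no_kernel:
  assumes "\<And>k. Re (omega (1/2) z $ k * v) = 0"
  shows "v = 0"
proof (rule ccontr)
  assume v: "v \<noteq> 0"
  have 1: "Im (z * v) = 0" and 2: "Re ((z\<^sup>2 + 1/2) * v) = 0" and 3: "Im ((z ^ 4 + 1) * v) = 0"
    using assms[of 1] assms[of 2] assms[of 3] by (simp_all add: omega_def vector_3 algebra_simps)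
  show False
  proof (cases "z = 0")
    case True
    then show False
      using v 2 3 by (simp add: complex_eq_iff)
  next
    case False
    define r where "r = Re (z * v)"
    have zv: "z * v = of_real r"
      using 1 by (simp add: r_def complex_eq_iff)
    then have "r \<noteq> 0"
      using v False by auto
    \<comment> \<open>Scaling by \<open>(norm z)^2\<close> expresses \<open>v\<close> through
      \<open>cnj z\<close> without division.\<close>
    have v_eq: "v * of_real ((norm z)\<^sup>2) = of_real r * cnj z"
      unfolding complex_norm_square by (simp flip: zv)
    have real_mult: "Re (c * of_real t) = Re c * t" "Im (c * of_real t) = Im c * t" for c t
      by simp_all
    have "Re ((z\<^sup>2 + 1/2) * (of_real r * cnj z)) = 0" "Im ((z ^ 4 + 1) * (of_real r * cnj z)) = 0"
      using 2 3 unfolding v_eq[symmetric] mult.assoc[symmetric] real_mult by simp_all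
    then have 2: "Re ((z\<^sup>2 + 1/2) * cnj z) = 0" and 3: "Im ((z ^ 4 + 1) * cnj z) = 0"
      using \<open>r \<noteq> 0\<close> unfolding mult.left_commute[of _ "of_real r"] by simp_all
    have "Re ((z\<^sup>2 + 1/2) * cnj z) = Re z * ((norm z)\<^sup>2 + 1/2)"
      unfolding cmod_power2 by (simp add: algebra_simps power2_eq_square)
    moreover have "(norm z)\<^sup>2 + 1/2 > 0"
      by (intro add_nonneg_pos) auto
    ultimately have "Re z = 0"
      using 2 by auto
    then have "Im z * (Im z ^ 4 + 1) = 0"
      using 3 by (simp add: eval_nat_numeral algebra_simps)
    moreover have "Im z ^ 4 + 1 > 0"
      by (intro add_nonneg_pos) auto
    ultimately show False
      using \<open>Re z = 0\<close> False by (auto simp: complex_eq_iff)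
  qed
qed

lemma omega_surface_immersion: "immersion (harmonic_surface (omega (1/2)) z0)"
proof -
  let ?f = "harmonic_surface (omega (1/2)) z0"
  have "Ck k ?f" for k
    unfolding harmonic_surface_omega using Omega_has_field_derivative
    by (intro Ck_Re_holomorphic) (auto simp: holomorphic_on_open)
  moreover have "inj (frechet_derivative ?f (at z))" for z
  proof -
    have D: "(?f has_derivative (\<lambda>v. \<chi> k. Re (omega (1/2) z $ k * v))) (at z)"
      unfolding harmonic_surface_omega by (rule has_derivative_Re_vec[OF Omega_has_field_derivative])
    then have "linear (\<lambda>v. \<chi> k. Re (omega (1/2) z $ k * v))"
      by (rule has_derivative_linear)
    then show ?thesis
      unfolding frechet_derivative_at[OF D, symmetric]
      using omega_no_kernel[of z] by (simp add: linear_injective_0 vec_eq_iff)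
  qed
  ultimately show ?thesis
    by (simp add: immersion_def)
qed

lemma omega_surface_inj: "inj (harmonic_surface (omega (1/2)) z0)"
proof (rule injI)
  fix p q
  assume "harmonic_surface (omega (1/2)) z0 p = harmonic_surface (omega (1/2)) z0 q"
  then have "Re (Omega (1/2) p $ k) = Re (Omega (1/2) q $ k)" for k
    by (simp add: harmonic_surface_omega vec_eq_iff)
  from this[of 1] this[of 2] this[of 3] show "p = q"
    using coords_unique[of "Re p" "Im p" "Re q" "Im q"] by (simp add: Re_Omega complex_eq_iff)
qed

lemma omega_surface_proper: "proper_map euclidean euclidean (harmonic_surface (omega (1/2)) z0)"
proof -
  let ?f = "harmonic_surface (omega (1/2)) z0"
  have cont: "continuous_on UNIV ?f"
    using omega_surface_immersion C1_continuous unfolding immersion_def by blast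
  have "compact (?f -` K)" if K: "compact K" for K
  proof -
    obtain B where B: "\<And>w. w \<in> K \<Longrightarrow> norm w \<le> B"
      using compact_imp_bounded[OF K] unfolding bounded_iff by blast
    \<comment> \<open>The sum undoes the subtraction of the base point values, so \<open>M\<close>
      bounds the coordinates of the primitive itself.\<close>
    define M where "M = B + (\<Sum>k\<in>UNIV. \<bar>Re (Omega (1/2) z0 $ k)\<bar>)"
    have bound: "\<bar>Re (Omega (1/2) z $ k)\<bar> \<le> M" if "z \<in> ?f -` K" for z k
    proof -
      have "\<bar>Re (Omega (1/2) z $ k) - Re (Omega (1/2) z0 $ k)\<bar> \<le> B"
        using component_le_norm_cart[of "?f z" k] B[of "?f z"] that
        by (simp add: harmonic_surface_omega)
      moreover have "\<bar>Re (Omega (1/2) z0 $ k)\<bar> \<le> (\<Sum>k\<in>UNIV. \<bar>Re (Omega (1/2) z0 $ k)\<bar>)"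
        by (rule member_le_sum) auto
      ultimately show ?thesis
        unfolding M_def by linarith
    qed
    have "norm z \<le> (1 + 2 * M + 2 * M\<^sup>2) + (1 + 5 * M + 10 * M\<^sup>2)" if "z \<in> ?f -` K" for z
      using coords_bounded[of "Re z" "Im z" M] cmod_le[of z]
        bound[OF that, of 1] bound[OF that, of 2] bound[OF that, of 3]
      unfolding Re_Omega by linarith
    then have "bounded (?f -` K)"
      unfolding bounded_iff by blast
    moreover have "closed (?f -` K)"
      using closed_vimage[OF compact_imp_closed[OF K]] cont by blast
    ultimately show ?thesis
      by (simp add: compact_eq_bounded_closed)
  qed
  then show ?thesis
    by (simp add: proper_map_iff_compact_vimage[OF cont])
qed

theorem proposition3p5:
  fixes z0 :: complex
  shows "complete_surface (harmonic_surface (omega (1/2)) z0) \<and>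
         properly_embedded (harmonic_surface (omega (1/2)) z0)"
proof -
  have "properly_embedded (harmonic_surface (omega (1/2)) z0)"
    unfolding properly_embedded_def
    using omega_surface_immersion omega_surface_inj omega_surface_proper by blast
  then show ?thesis
    using properly_embedded_imp_complete by blast
qed

end
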